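(* Consider the difference problem $Cy+Dy=\varphi(\boldsymbol x)$, $\boldsymbol x\in\omega$, for grid functions with $y(\boldsymbol x)=0$, $\boldsymbol x\in\partial\omega$, where $$(Dy)_i=-\frac1{V_i}\sum_{j\in\mathcal W(i)}l_{ij}k(\boldsymbol x_{ij})\frac{y_j-y_i}{d(\boldsymbol x_i,\boldsymbol x_j)},\qquad \boldsymbol x_i\in\omega .$$ (a) (Upwind schemes.) The schemes with $$(Cy)_i=\frac1{V_i}\sum_{j\in\mathcal W(i)}l_{ij}b_{ij}^-(y_j-y_i)\quad\text{(nondivergent convective terms)}$$ and with $$(Cy)_i=\frac1{V_i}\sum_{j\in\mathcal W(i)}l_{ij}(b_{ij}^-y_j+b_{ij}^+y_i)\quad\text{(divergent convective terms)}$$ are unconditionally monotone. (b) (Central-difference schemes.) The schemes with $$(Cy)_i=\frac1{V_i}\sum_{j\in\mathcal W(i)}l_{ij}b_{ij}\frac{y_j-y_i}2\quad\text{(nondivergent)}\qquad\text{and with}\qquad (Cy)_i=\frac1{V_i}\sum_{j\in\mathcal W(i)}l_{ij}b_{ij}\frac{y_j+y_i}2\quad\text{(divergent)}$$ satisfy the maximum principle under the restrictions $$\mathrm{Pe}_{ij}=\frac{|b_{ij}|\,d(\boldsymbol x_i,\boldsymbol x_j)}{k(\boldsymbol x_{ij})}<2,\qquad j\in\mathcal W(i),\ \boldsymbol x_i\in\omega .$$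
   Context: A scheme is called monotone (satisfies the maximum principle) if its solution is non-negative (non-positive) on $\omega$ for every non-negative (non-positive) right-hand side $\varphi$. Setting: $\Omega\subset\mathbb R^2$ is a convex polygon with boundary $\partial\Omega$, $\overline\Omega=\Omega\cup\partial\Omega$. $\overline\omega=\{\boldsymbol x_1,\dots,\boldsymbol x_M\}\subset\overline\Omega$ is a finite set of nodes containing all vertices of $\Omega$; $\omega=\overline\omega\cap\Omega$, $\partial\omega=\overline\omega\cap\partial\Omega$. The control volume $\Omega_i$ of $\boldsymbol x_i$ is the Voronoi polygon of $\boldsymbol x_i$ (the set of points closer to $\boldsymbol x_i$ than to all other nodes), or its part belonging to $\Omega$. $\Gamma_{ij}=\partial\Omega_i\cap\partial\Omega_j$ is the common face, $\mathcal W(i)$ is the set of indices $j\ne i$ for which $\Omega_j$ has a common face (of positive length) with $\Omega_i$; the grid $\overline\omega$ is connected (with respect to this neighbor relation). $V_i$ is the area of $\Omega_i$, $l_{ij}$ the length of $\Gamma_{ij}$, $d(\boldsymbol x_i,\boldsymbol x_j)$ the Euclidean distance, $\boldsymbol x_{ij}=(\boldsymbol x_i+\boldsymbol x_j)/2$. $k$ is a function with $k(\boldsymbol x)\ge\kappa_1>0$, $\boldsymbol v$ is a vector field (both sufficiently smooth on $\overline\Omega$), $b_{ij}=(\boldsymbol v,\boldsymbol n)(\boldsymbol x_{ij})$ with $\boldsymbol n$ the unit normal to $\Gamma_{ij}$ outer to $\Omega_i$ (so $b_{ij}=-b_{ji}$), $b_{ij}^\pm=\frac12(b_{ij}\pm|b_{ij}|)$.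 The nondivergent and divergent convection-diffusion equations being approximated are $\boldsymbol v\cdot\nabla u-\nabla\cdot(k\nabla u)=f$ and $\nabla\cdot(\boldsymbol v u)-\nabla\cdot(k\nabla u)=f$ with $u=0$ on $\partial\Omega$. *)

theory Defs
  imports "HOL-Analysis.Analysis"
begin

text \<open>A convex polygon is a nonempty open convex domain of the plane whose closure is a polytope;
  its boundary is \<^term>\<open>frontier \<Omega>\<close> and its vertices are the extreme points of \<^term>\<open>closure \<Omega>\<close>.\<close>

definition convex_polygon :: "(real^2) set \<Rightarrow> bool" where
  "convex_polygon \<Omega> \<longleftrightarrow> \<Omega> \<noteq> {} \<and> open \<Omega> \<and> convex \<Omega> \<and> polytope (closure \<Omega>)"

definition vertices :: "(real^2) set \<Rightarrow> (real^2) set" where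
  "vertices \<Omega> = {p. p extreme_point_of (closure \<Omega>)}"

definition C1_on :: "'a::real_normed_vector set \<Rightarrow> ('a \<Rightarrow> 'b::real_normed_vector) \<Rightarrow> bool" where
  "C1_on S f \<longleftrightarrow> (\<exists>f' :: 'a \<Rightarrow> 'a \<Rightarrow>\<^sub>L 'b. continuous_on S f' \<and>
      (\<forall>p\<in>S. (f has_derivative blinfun_apply (f' p)) (at p within S)))"

text \<open>The unit normal to a nondegenerate segment \<open>F\<close> on the boundary of an open convex
  set \<open>S\<close>, pointing out of \<open>S\<close>; for the faces of the grid it exists and is unique, see
  \<open>outer_unit_normal_face\<close> below.\<close>

definition outer_unit_normal :: "(real^2) set \<Rightarrow> (real^2) set \<Rightarrow> real^2" where
  "outer_unit_normal S F = (THE n. norm n = 1 \<and>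
      (\<forall>p\<in>F. \<forall>q\<in>F. n \<bullet> (p - q) = 0) \<and> (\<forall>p\<in>F. \<forall>z\<in>S. n \<bullet> (z - p) \<le> 0))"

text \<open>Nodes are \<open>x 1, \<dots>, x M\<close>, and a grid function \<open>y\<close> is given by its values \<open>y i\<close> at the
  nodes \<open>x i\<close>; values at indices outside \<open>{1..M}\<close> play no role.\<close>

context
  fixes \<Omega> :: "(real^2) set" and M :: nat and x :: "nat \<Rightarrow> real^2"
begin

definition inner_nodes :: "nat set" where
  "inner_nodes = {i \<in> {1..M}. x i \<in> \<Omega>}"

definition boundary_nodes :: "nat set" where
  "boundary_nodes = {i \<in> {1..M}. x i \<in> frontier \<Omega>}"

definition control_volume :: "nat \<Rightarrow> (real^2) set" where
  "control_volume i = {p \<in> \<Omega>. \<forall>j\<in>{1..M} - {i}. dist p (x i) < dist p (x j)}"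

definition face :: "nat \<Rightarrow> nat \<Rightarrow> (real^2) set" where
  "face i j = frontier (control_volume i) \<inter> frontier (control_volume j)"

text \<open>Faces are segments (see \<open>face_segment\<close> below), whose length is their diameter.\<close>

definition face_length :: "nat \<Rightarrow> nat \<Rightarrow> real" where
  "face_length i j = diameter (face i j)"

definition neighbors :: "nat \<Rightarrow> nat set" where
  "neighbors i = {j \<in> {1..M} - {i}. face_length i j > 0}"

definition grid_connected :: bool where
  "grid_connected \<longleftrightarrow> (\<forall>i\<in>{1..M}. \<forall>j\<in>{1..M}.
      (i, j) \<in> {(m, n). m \<in> {1..M} \<and> n \<in> neighbors m}\<^sup>*)"

definition area :: "nat \<Rightarrow> real" where
  "area i = measure lborel (control_volume i)"

definition is_solution :: "((nat \<Rightarrow> real) \<Rightarrow> nat \<Rightarrow> real) \<Rightarrow> (nat \<Rightarrow> real) \<Rightarrow> (nat \<Rightarrow> real) \<Rightarrow> bool" where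
  "is_solution A \<phi> y \<longleftrightarrow>
      (\<forall>i\<in>inner_nodes. A y i = \<phi> i) \<and> (\<forall>i\<in>boundary_nodes. y i = 0)"

definition monotone_scheme :: "((nat \<Rightarrow> real) \<Rightarrow> nat \<Rightarrow> real) \<Rightarrow> bool" where
  "monotone_scheme A \<longleftrightarrow> (\<forall>\<phi> y. is_solution A \<phi> y \<longrightarrow>
      ((\<forall>i\<in>inner_nodes. \<phi> i \<ge> 0) \<longrightarrow> (\<forall>i\<in>inner_nodes. y i \<ge> 0)) \<and>
      ((\<forall>i\<in>inner_nodes. \<phi> i \<le> 0) \<longrightarrow> (\<forall>i\<in>inner_nodes. y i \<le> 0)))"

definition diffusion :: "(real^2 \<Rightarrow> real) \<Rightarrow> (nat \<Rightarrow> real) \<Rightarrow> nat \<Rightarrow> real" where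
  "diffusion k y i = - (1 / area i) *
      (\<Sum>j\<in>neighbors i. face_length i j * k (midpoint (x i) (x j)) *
         ((y j - y i) / dist (x i) (x j)))"

definition normal_velocity :: "(real^2 \<Rightarrow> real^2) \<Rightarrow> nat \<Rightarrow> nat \<Rightarrow> real" where
  "normal_velocity v i j =
      v (midpoint (x i) (x j)) \<bullet> outer_unit_normal (control_volume i) (face i j)"

definition velocity_pos :: "(real^2 \<Rightarrow> real^2) \<Rightarrow> nat \<Rightarrow> nat \<Rightarrow> real" where
  "velocity_pos v i j = 1/2 * (normal_velocity v i j + \<bar>normal_velocity v i j\<bar>)"

definition velocity_neg :: "(real^2 \<Rightarrow> real^2) \<Rightarrow> nat \<Rightarrow> nat \<Rightarrow> real" where
  "velocity_neg v i j = 1/2 * (normal_velocity v i j - \<bar>normal_velocity v i j\<bar>)"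

definition upwind_nondivergent :: "(real^2 \<Rightarrow> real^2) \<Rightarrow> (nat \<Rightarrow> real) \<Rightarrow> nat \<Rightarrow> real" where
  "upwind_nondivergent v y i = 1 / area i *
      (\<Sum>j\<in>neighbors i. face_length i j * velocity_neg v i j * (y j - y i))"

definition upwind_divergent :: "(real^2 \<Rightarrow> real^2) \<Rightarrow> (nat \<Rightarrow> real) \<Rightarrow> nat \<Rightarrow> real" where
  "upwind_divergent v y i = 1 / area i *
      (\<Sum>j\<in>neighbors i. face_length i j * (velocity_neg v i j * y j + velocity_pos v i j * y i))"

definition central_nondivergent :: "(real^2 \<Rightarrow> real^2) \<Rightarrow> (nat \<Rightarrow> real) \<Rightarrow> nat \<Rightarrow> real" where
  "central_nondivergent v y i = 1 / area i *
      (\<Sum>j\<in>neighbors i. face_length i j * normal_velocity v i j * ((y j - y i) / 2))"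

definition central_divergent :: "(real^2 \<Rightarrow> real^2) \<Rightarrow> (nat \<Rightarrow> real) \<Rightarrow> nat \<Rightarrow> real" where
  "central_divergent v y i = 1 / area i *
      (\<Sum>j\<in>neighbors i. face_length i j * normal_velocity v i j * ((y j + y i) / 2))"

definition peclet :: "(real^2 \<Rightarrow> real) \<Rightarrow> (real^2 \<Rightarrow> real^2) \<Rightarrow> nat \<Rightarrow> nat \<Rightarrow> real" where
  "peclet k v i j =
      \<bar>normal_velocity v i j\<bar> * dist (x i) (x j) / k (midpoint (x i) (x j))"

lemma control_volume_open:
  assumes "open \<Omega>" shows "open (control_volume i)"
proof -
  have "control_volume i = \<Omega> \<inter> (\<Inter>j\<in>{1..M} - {i}. {p. dist p (x i) < dist p (x j)})"
    by (auto simp: control_volume_def)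
  moreover have "open {p. dist p (x i) < dist p (x j)}" for j
    by (intro open_Collect_less continuous_intros)
  ultimately show ?thesis using assms by (simp only:) (intro open_Int open_INT ballI finite_Diff finite_atLeastAtMost; assumption)
qed

lemma dist_less_iff_inner:
  fixes p a b :: "real^2"
  shows "dist p a < dist p b \<longleftrightarrow> 2 * ((b - a) \<bullet> p) < b \<bullet> b - a \<bullet> a"
    and "dist p a = dist p b \<longleftrightarrow> 2 * ((b - a) \<bullet> p) = b \<bullet> b - a \<bullet> a"
  unfolding dist_norm norm_eq_sqrt_inner
  by (simp_all add: inner_diff_left inner_diff_right inner_commute algebra_simps)

lemma control_volume_convex:
  assumes "convex \<Omega>" shows "convex (control_volume i)"
proof -
  have "control_volume i =
      \<Omega> \<inter> (\<Inter>j\<in>{1..M} - {i}. {p. (2 *\<^sub>R (x j - x i)) \<bullet> p < x j \<bullet> x j - x i \<bullet> x i})"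
    by (auto simp: control_volume_def dist_less_iff_inner)
  then show ?thesis
    using assms by (simp only:) (intro convex_Int convex_INT convex_halfspace_lt; assumption)
qed

lemma face_bisector:
  assumes "i \<in> {1..M}" "j \<in> {1..M}" "i \<noteq> j" "p \<in> face i j"
  shows "dist p (x i) = dist p (x j)"
proof -
  have cl: "dist p (x a) \<le> dist p (x b)"
    if "b \<in> {1..M}" "a \<noteq> b" "p \<in> closure (control_volume a)" for a b
  proof -
    have "control_volume a \<subseteq> {q. dist q (x a) \<le> dist q (x b)}"
    proof
      fix q assume "q \<in> control_volume a"
      then have "dist q (x a) < dist q (x b)"
        using that(1,2) by (simp add: control_volume_def)
      then show "q \<in> {q. dist q (x a) \<le> dist q (x b)}" by simp
    qed
    moreover have "closed {q. dist q (x a) \<le> dist q (x b)}"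
      by (intro closed_Collect_le continuous_on_dist continuous_on_id continuous_on_const)
    ultimately have "closure (control_volume a) \<subseteq> {q. dist q (x a) \<le> dist q (x b)}"
      by (rule closure_minimal)
    then show ?thesis using that(3) by blast
  qed
  have "p \<in> closure (control_volume i)" "p \<in> closure (control_volume j)"
    using assms(4) by (simp_all add: face_def frontier_def)
  then show ?thesis
    using cl[OF assms(2,3)] cl[OF assms(1) not_sym[OF assms(3)]] by simp
qed

lemma face_segment:
  assumes "convex_polygon \<Omega>" "inj_on x {1..M}" "i \<in> {1..M}" "j \<in> {1..M}" "i \<noteq> j" "face i j \<noteq> {}"
  obtains a b where "face i j = closed_segment a b" "face_length i j = dist a b"
proof -
  have op: "open (control_volume m)" and cv: "convex (control_volume m)" for m
    using assms(1) control_volume_open control_volume_convex by (auto simp: convex_polygon_def)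
  have dis: "control_volume i \<inter> control_volume j = {}"
  proof -
    have "dist p (x i) < dist p (x j)" "dist p (x j) < dist p (x i)"
      if "p \<in> control_volume i" "p \<in> control_volume j" for p
      using that assms(3-5) by (auto simp: control_volume_def)
    then show ?thesis by fastforce
  qed
  have "face i j = closure (control_volume i) \<inter> closure (control_volume j)"
    using op dis open_Int_closure_eq_empty[of "control_volume i" "control_volume j"]
      open_Int_closure_eq_empty[of "control_volume j" "control_volume i"]
    by (auto simp: face_def frontier_def interior_open)
  then have conv: "convex (face i j)" using cv by (simp add: convex_Int convex_closure)
  have "bounded (control_volume i)"
    using assms(1) by (auto simp: convex_polygon_def control_volume_def
        intro: bounded_subset[OF polytope_imp_bounded[of "closure \<Omega>"]] closure_subset[THEN subsetD])
  then have comp: "compact (face i j)"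
    by (simp add: face_def compact_Int_closed compact_frontier_bounded)
  have "x i \<noteq> x j" using assms(3-5) inj_onD[OF assms(2)] by blast
  then have "2 *\<^sub>R (x j - x i) \<noteq> 0" by simp
  then have "aff_dim {p. (2 *\<^sub>R (x j - x i)) \<bullet> p = x j \<bullet> x j - x i \<bullet> x i} = 1"
    by (subst aff_dim_hyperplane) auto
  moreover have "face i j \<subseteq> {p. (2 *\<^sub>R (x j - x i)) \<bullet> p = x j \<bullet> x j - x i \<bullet> x i}"
    using face_bisector[OF assms(3-5)] by (auto simp: dist_less_iff_inner)
  ultimately have "aff_dim (face i j) \<le> 1"
    using aff_dim_subset by metis
  then have "collinear (face i j)" by (simp add: collinear_aff_dim)
  then obtain a b where ab: "face i j = closed_segment a b"
    using compact_convex_collinear_segment[OF assms(6) comp conv] by blast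
  moreover have "diameter (closed_segment a b) = dist a b"
  proof (rule antisym)
    show "diameter (closed_segment a b) \<le> dist a b"
    proof (rule diameter_le)
      fix s t assume st: "s \<in> closed_segment a b" "t \<in> closed_segment a b"
      have "dist s a \<le> dist a b" "dist s b \<le> dist a b"
        using dist_in_closed_segment[OF st(1)] by simp_all
      then show "norm (s - t) \<le> dist a b"
        using dist_decreases_closed_segment[OF st(2), of s] by (auto simp: dist_norm)
    qed simp
    show "dist a b \<le> diameter (closed_segment a b)"
      by (rule diameter_bounded_bound) (auto intro: compact_imp_bounded)
  qed
  ultimately show thesis
    using that by (simp only: face_length_def)
qed

lemma outer_unit_normal_face:
  assumes "i \<in> {1..M}" "j \<in> neighbors i"
  shows "outer_unit_normal (control_volume i) (face i j) =
      (x j - x i) /\<^sub>R dist (x i) (x j)"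
proof -
  have j: "j \<in> {1..M}" "i \<noteq> j" and pos: "diameter (face i j) > 0"
    using assms(2) by (auto simp: neighbors_def face_length_def)
  have "\<not> (\<exists>p. face i j \<subseteq> {p})"
  proof
    assume "\<exists>p. face i j \<subseteq> {p}"
    then obtain p where "face i j = {} \<or> face i j = {p}" by blast
    then show False using pos by auto
  qed
  then obtain p q where pq: "p \<in> face i j" "q \<in> face i j" "p \<noteq> q"
    by blast
  define w where "w = x j - x i"
  have eq: "2 * (w \<bullet> s) = x j \<bullet> x j - x i \<bullet> x i" if "s \<in> face i j" for s
    using face_bisector[OF assms(1) j that] by (simp add: dist_less_iff_inner w_def)
  have lt: "2 * (w \<bullet> z) < x j \<bullet> x j - x i \<bullet> x i" if "z \<in> control_volume i" for z
  proof -
    have "dist z (x i) < dist z (x j)"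
      using that j by (auto simp: control_volume_def)
    then show ?thesis by (simp add: dist_less_iff_inner w_def)
  qed
  have "control_volume i \<noteq> {}"
    using pq(1) by (auto simp: face_def)
  then obtain z where z: "z \<in> control_volume i" by blast
  have w0: "w \<noteq> 0" using lt[OF z] eq[OF pq(1)] by auto
  have d: "dist (x i) (x j) = norm w" by (simp add: w_def dist_norm norm_minus_commute)
  show ?thesis
    unfolding outer_unit_normal_def d w_def[symmetric]
  proof (rule the_equality)
    have "w \<bullet> (s - t) = 0" if "s \<in> face i j" "t \<in> face i j" for s t
      using eq[OF that(1)] eq[OF that(2)] by (simp add: inner_diff_right)
    moreover have "w \<bullet> (y - s) \<le> 0" if "s \<in> face i j" "y \<in> control_volume i" for s y
      using eq[OF that(1)] lt[OF that(2)] by (simp add: inner_diff_right)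
    ultimately show "norm (w /\<^sub>R norm w) = 1 \<and>
        (\<forall>p\<in>face i j. \<forall>q\<in>face i j. (w /\<^sub>R norm w) \<bullet> (p - q) = 0) \<and>
        (\<forall>p\<in>face i j. \<forall>z\<in>control_volume i. (w /\<^sub>R norm w) \<bullet> (z - p) \<le> 0)"
      using w0 by (auto simp: divide_simps mult_le_0_iff)
  next
    fix n
    assume n: "norm n = 1 \<and> (\<forall>p\<in>face i j. \<forall>q\<in>face i j. n \<bullet> (p - q) = 0) \<and>
        (\<forall>p\<in>face i j. \<forall>z\<in>control_volume i. n \<bullet> (z - p) \<le> 0)"
    define u where "u = p - q"
    have "u \<noteq> 0" "n \<bullet> u = 0"
      using pq n unfolding u_def by (simp, blast)
    moreover have "w \<bullet> u = 0"
      using eq[OF pq(1)] eq[OF pq(2)] by (simp add: u_def inner_diff_right)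
    ultimately have u: "u \<noteq> 0" "n \<bullet> u = 0" "w \<bullet> u = 0" by simp_all
    have "n $ 1 * u $ 1 + n $ 2 * u $ 2 = 0" "w $ 1 * u $ 1 + w $ 2 * u $ 2 = 0"
      using u by (simp_all add: inner_vec_def sum_2)
    moreover have "u $ 1 \<noteq> 0 \<or> u $ 2 \<noteq> 0"
      using u(1) by (auto simp: vec_eq_iff forall_2)
    ultimately have det: "n $ 1 * w $ 2 = n $ 2 * w $ 1"
    proof -
      assume e: "n $ 1 * u $ 1 + n $ 2 * u $ 2 = 0" "w $ 1 * u $ 1 + w $ 2 * u $ 2 = 0"
        and "u $ 1 \<noteq> 0 \<or> u $ 2 \<noteq> 0"
      have "u $ 1 * (n $ 1 * w $ 2 - n $ 2 * w $ 1) =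
          w $ 2 * (n $ 1 * u $ 1 + n $ 2 * u $ 2) - n $ 2 * (w $ 1 * u $ 1 + w $ 2 * u $ 2)"
        "u $ 2 * (n $ 1 * w $ 2 - n $ 2 * w $ 1) =
          n $ 1 * (w $ 1 * u $ 1 + w $ 2 * u $ 2) - w $ 1 * (n $ 1 * u $ 1 + n $ 2 * u $ 2)"
        by (simp_all add: algebra_simps)
      then show ?thesis using e \<open>u $ 1 \<noteq> 0 \<or> u $ 2 \<noteq> 0\<close> by auto
    qed
    have "(w \<bullet> w) *\<^sub>R n = (n \<bullet> w) *\<^sub>R w"
    proof -
      have "((w $ 1)^2 + (w $ 2)^2) * n $ 1 = (n $ 1 * w $ 1 + n $ 2 * w $ 2) * w $ 1"
        "((w $ 1)^2 + (w $ 2)^2) * n $ 2 = (n $ 1 * w $ 1 + n $ 2 * w $ 2) * w $ 2"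
      proof -
        have "((w $ 1)^2 + (w $ 2)^2) * n $ 1 - (n $ 1 * w $ 1 + n $ 2 * w $ 2) * w $ 1 =
            w $ 2 * (n $ 1 * w $ 2 - n $ 2 * w $ 1)"
          "((w $ 1)^2 + (w $ 2)^2) * n $ 2 - (n $ 1 * w $ 1 + n $ 2 * w $ 2) * w $ 2 =
            - w $ 1 * (n $ 1 * w $ 2 - n $ 2 * w $ 1)"
          by (simp_all add: algebra_simps power2_eq_square)
        then show "((w $ 1)^2 + (w $ 2)^2) * n $ 1 = (n $ 1 * w $ 1 + n $ 2 * w $ 2) * w $ 1"
          "((w $ 1)^2 + (w $ 2)^2) * n $ 2 = (n $ 1 * w $ 1 + n $ 2 * w $ 2) * w $ 2"
          using det by simp_all
      qed
      then show ?thesis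
        by (simp add: vec_eq_iff forall_2 inner_vec_def sum_2 power2_eq_square)
    qed
    then have "(1 / (w \<bullet> w)) *\<^sub>R (w \<bullet> w) *\<^sub>R n = (1 / (w \<bullet> w)) *\<^sub>R (n \<bullet> w) *\<^sub>R w"
      by (rule arg_cong)
    then obtain c where nc: "n = c *\<^sub>R w"
      using w0 by simp
    have "n \<bullet> (z - p) \<le> 0" using n z pq(1) by blast
    then have "c * (w \<bullet> (z - p)) \<le> 0" by (simp add: nc)
    moreover have "w \<bullet> (z - p) < 0"
      using lt[OF z] eq[OF pq(1)] by (simp add: inner_diff_right)
    ultimately have "c \<ge> 0" by (auto simp: mult_le_0_iff)
    moreover have "\<bar>c\<bar> * norm w = 1" using n nc by simp
    ultimately show "n = w /\<^sub>R norm w"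
      using w0 by (simp add: nc nonzero_eq_divide_eq[symmetric] inverse_eq_divide)
  qed
qed

end

end

theory Submission
  imports Defs
begin

text \<open>Multiplied by the area, each scheme reads
  \<open>\<Sum>j. (a i j * y i - c i j * y j)\<close> with positive \<open>a\<close> and \<open>c\<close>. In the nondivergent case
  \<open>c = a\<close>: a negative minimum propagates to all neighbours, hence to a boundary node. In the
  divergent case \<open>c\<close> is the transpose of \<open>a\<close>: summing over the set where \<open>y < 0\<close>, the
  contributions of pairs inside this set cancel and every edge leaving it contributes a negative
  amount, so no edge leaves it, although some boundary node lies outside.\<close>

section \<open>Minimum principles on a connected graph\<close>

lemma rtrancl_neighbor_closed:
  assumes "(i, j) \<in> {(m, n). m \<in> N \<and> n \<in> W m}\<^sup>*" "i \<in> S" "\<And>m. m \<in> S \<Longrightarrow> W m \<subseteq> S"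
  shows "j \<in> S"
  using assms(1,2) by (induction rule: rtrancl_induct) (use assms(3) in auto)

text \<open>At a minimiser every summand is non-positive while the sum is not negative, so all
  summands vanish and \<open>a > 0\<close> makes each neighbour a minimiser too. The inequality is
  available on \<open>I\<close> only; minimisers of a negative minimum lie there because
  \<open>y\<close> is non-negative on \<open>N - I\<close>.\<close>

lemma minimum_principle:
  fixes y :: "'n \<Rightarrow> real" and a :: "'n \<Rightarrow> 'n \<Rightarrow> real"
  assumes "finite N" and W: "\<And>i. W i \<subseteq> N" and "I \<subseteq> N"
    and conn: "\<forall>i\<in>N. \<forall>j\<in>N. (i, j) \<in> {(m, n). m \<in> N \<and> n \<in> W m}\<^sup>*"
    and b: "b \<in> N - I" and bdry: "\<And>j. j \<in> N - I \<Longrightarrow> y j \<ge> 0"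
    and pos: "\<And>i j. i \<in> I \<Longrightarrow> j \<in> W i \<Longrightarrow> a i j > 0"
    and super: "\<And>i. i \<in> I \<Longrightarrow> 0 \<le> (\<Sum>j\<in>W i. a i j * (y i - y j))"
    and "i \<in> I"
  shows "y i \<ge> 0"
proof (rule ccontr)
  assume neg: "\<not> y i \<ge> 0"
  \<comment> \<open>The minimum runs over all of \<open>N\<close>, since neighbours of a node of
    \<open>I\<close> may lie outside \<open>I\<close>.\<close>
  define \<mu> where "\<mu> = Min (y ` N)"
  define S where "S = {m \<in> N. y m = \<mu>}"
  have le: "\<mu> \<le> y m" if "m \<in> N" for m
    using that \<open>finite N\<close> by (simp add: \<mu>_def)
  have "\<mu> \<in> y ` N"
    unfolding \<mu>_def using \<open>finite N\<close> b by (intro Min_in) auto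
  then obtain s where s: "s \<in> S" by (auto simp: S_def)
  have "\<mu> < 0" using le[of i] neg \<open>i \<in> I\<close> \<open>I \<subseteq> N\<close> by auto
  then have "S \<subseteq> I" using bdry by (force simp: S_def)
  have "W m \<subseteq> S" if "m \<in> S" for m
  proof -
    have m: "m \<in> I" "y m = \<mu>" using that \<open>S \<subseteq> I\<close> by (auto simp: S_def)
    have nonpos: "a m j * (y m - y j) \<le> 0" if "j \<in> W m" for j
      using pos[OF m(1) that] le[of j] W that m(2) by (auto simp: mult_le_0_iff)
    have "finite (W m)" using W \<open>finite N\<close> by (rule finite_subset)
    \<comment> \<open>The summands are negated so that a vanishing sum of non-negative terms forces
      each term to vanish.\<close>
    moreover have "(\<Sum>j\<in>W m. - (a m j * (y m - y j))) = 0"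
      using super[OF m(1)] sum_nonpos[of "W m" "\<lambda>j. a m j * (y m - y j)"] nonpos
      by (simp add: sum_negf)
    ultimately have "\<forall>j\<in>W m. - (a m j * (y m - y j)) = 0"
      using nonpos by (subst (asm) sum_nonneg_eq_0_iff) auto
    then show ?thesis using pos[OF m(1)] W m(2) by (fastforce simp: S_def)
  qed
  then have "b \<in> S"
    using rtrancl_neighbor_closed[of s b N W S] conn s b by (auto simp: S_def)
  then show False using b \<open>S \<subseteq> I\<close> by blast
qed

text \<open>Here the columns of the matrix balance rather than its rows, so a minimum need not
  propagate, and the inequalities are added over many nodes instead of being read off at one.
  \<open>sym\<close> ensures that an edge inside the negative set is met in both directions.\<close>

lemma minimum_principle_transposed:
  fixes y :: "'n \<Rightarrow> real" and a :: "'n \<Rightarrow> 'n \<Rightarrow> real"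
  assumes "finite N" and W: "\<And>i. W i \<subseteq> N" and "I \<subseteq> N"
    and conn: "\<forall>i\<in>N. \<forall>j\<in>N. (i, j) \<in> {(m, n). m \<in> N \<and> n \<in> W m}\<^sup>*"
    and b: "b \<in> N - I" and bdry: "\<And>j. j \<in> N - I \<Longrightarrow> y j \<ge> 0"
    and sym: "\<And>i j. i \<in> N \<Longrightarrow> j \<in> W i \<Longrightarrow> i \<in> W j"
    and pos: "\<And>i j. i \<in> I \<Longrightarrow> j \<in> W i \<Longrightarrow> a i j > 0 \<and> a j i > 0"
    and super: "\<And>i. i \<in> I \<Longrightarrow> 0 \<le> (\<Sum>j\<in>W i. a i j * y i - a j i * y j)"
    and "i \<in> I"
  shows "y i \<ge> 0"
proof (rule ccontr)
  assume neg: "\<not> y i \<ge> 0"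
  define S where "S = {m \<in> N. y m < 0}"
  \<comment> \<open>The flux along the edge from \<open>m\<close> to \<open>j\<close>; it is
    antisymmetric.\<close>
  define f where "f m j = a m j * y m - a j m * y j" for m j
  have "S \<subseteq> I" using bdry by (force simp: S_def)
  have fin: "finite S" "finite (W m)" for m
    using \<open>finite N\<close> finite_subset[OF W] by (simp_all add: S_def)
  \<comment> \<open>Strictness comes from \<open>a m j * y m\<close> alone: \<open>y j\<close> may
    be 0, as at boundary nodes.\<close>
  have out: "f m j < 0" if "m \<in> S" "j \<in> W m - S" for m j
  proof -
    have "a m j > 0" "a j m > 0" "y m < 0" "y j \<ge> 0"
      using that pos[of m j] \<open>S \<subseteq> I\<close> W by (force simp: S_def)+
    then have "a m j * y m < 0" "0 \<le> a j m * y j"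
      by (simp_all add: mult_less_0_iff)
    then show ?thesis by (simp add: f_def)
  qed
  have inner_cancel: "(\<Sum>m\<in>S. \<Sum>j\<in>W m \<inter> S. f m j) = 0"
  proof -
    \<comment> \<open>Extending the flux by zero to all pairs in \<open>S\<close> makes the domain a
      product, so the two sums can be swapped; antisymmetry then makes the double sum equal to its
      own negative.\<close>
    define g where "g m j = (if j \<in> W m then f m j else 0)" for m j
    have anti: "g m j = - g j m" if "m \<in> S" "j \<in> S" for m j
      using that sym by (auto simp: g_def f_def S_def)
    have "(\<Sum>m\<in>S. \<Sum>j\<in>S. g m j) = - (\<Sum>m\<in>S. \<Sum>j\<in>S. g j m)"
      unfolding sum_negf[symmetric] by (intro sum.cong refl anti)
    also have "(\<Sum>m\<in>S. \<Sum>j\<in>S. g j m) = (\<Sum>m\<in>S. \<Sum>j\<in>S. g m j)"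
      by (rule sum.swap)
    finally have "(\<Sum>m\<in>S. \<Sum>j\<in>S. g m j) = 0" by simp
    moreover have "(\<Sum>j\<in>S. g m j) = (\<Sum>j\<in>W m \<inter> S. f m j)" for m
      using fin(1) by (simp add: g_def sum.inter_restrict Int_commute)
    ultimately show ?thesis by simp
  qed
  \<comment> \<open>Adding the inequalities over \<open>S\<close> and splitting off the internal
    edges leaves only the outgoing flux.\<close>
  have "0 \<le> (\<Sum>m\<in>S. \<Sum>j\<in>W m. f m j)"
    unfolding f_def by (rule sum_nonneg) (use super \<open>S \<subseteq> I\<close> in blast)
  also have "\<dots> = (\<Sum>m\<in>S. (\<Sum>j\<in>W m \<inter> S. f m j) + (\<Sum>j\<in>W m - S. f m j))"
    by (rule sum.cong[OF refl sum.Int_Diff[OF fin(2)]])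
  finally have total: "0 \<le> (\<Sum>m\<in>S. \<Sum>j\<in>W m - S. f m j)"
    using inner_cancel by (simp add: sum.distrib)
  \<comment> \<open>A single edge leaving \<open>S\<close> would make the total outgoing flux
    negative, against \<open>total\<close>.\<close>
  have "W m \<subseteq> S" if "m \<in> S" for m
  proof (rule ccontr)
    assume "\<not> W m \<subseteq> S"
    then have "(\<Sum>j\<in>W m - S. f m j) < 0"
      using out[OF that] fin by (intro sum_strict_mono[of _ _ "\<lambda>_. 0", simplified]) auto
    moreover have "(\<Sum>j\<in>W n - S. f n j) \<le> 0" if "n \<in> S" for n
      using out[OF that] by (intro sum_nonpos) (simp add: less_imp_le)
    ultimately have "(\<Sum>m\<in>S. \<Sum>j\<in>W m - S. f m j) < (\<Sum>m\<in>S. 0)"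
      using that fin(1) by (intro sum_strict_mono_ex1) auto
    then show False using total by simp
  qed
  moreover have "i \<in> S" using neg \<open>i \<in> I\<close> \<open>I \<subseteq> N\<close> by (auto simp: S_def)
  ultimately have "b \<in> S"
    using rtrancl_neighbor_closed[of i b N W S] conn b by (auto simp: S_def)
  then show False using b \<open>S \<subseteq> I\<close> by blast
qed

text \<open>The non-positive half of monotonicity is the non-negative half applied to
  \<open>-y\<close>, by oddness of \<open>A\<close>.\<close>

lemma monotone_schemeI:
  assumes odd: "\<And>y i. i \<in> inner_nodes \<Omega> M x \<Longrightarrow> A (\<lambda>j. - y j) i = - A y i"
    and nonneg: "\<And>y i. \<lbrakk>\<And>i. i \<in> inner_nodes \<Omega> M x \<Longrightarrow> A y i \<ge> 0;
      \<And>i. i \<in> boundary_nodes \<Omega> M x \<Longrightarrow> y i = 0; i \<in> inner_nodes \<Omega> M x\<rbrakk> \<Longrightarrow> y i \<ge> 0"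
  shows "monotone_scheme \<Omega> M x A"
  unfolding monotone_scheme_def is_solution_def
proof (intro allI impI conjI ballI)
  fix \<phi> y i
  assume sol: "(\<forall>i\<in>inner_nodes \<Omega> M x. A y i = \<phi> i) \<and> (\<forall>i\<in>boundary_nodes \<Omega> M x. y i = 0)"
    and i: "i \<in> inner_nodes \<Omega> M x"
  show "0 \<le> y i" if "\<forall>i\<in>inner_nodes \<Omega> M x. 0 \<le> \<phi> i"
    using nonneg[of y i] sol i that by simp
  show "y i \<le> 0" if "\<forall>i\<in>inner_nodes \<Omega> M x. \<phi> i \<le> 0"
    using nonneg[of "\<lambda>j. - y j" i] sol i that odd by simp
qed

section \<open>Behaviour of the grid data under exchange of two neighbours\<close>

lemma face_length_commute: "face_length \<Omega> M x i j = face_length \<Omega> M x j i"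
  by (simp add: face_length_def face_def Int_commute)

lemma neighbors_subset: "neighbors \<Omega> M x i \<subseteq> {1..M}"
  by (auto simp: neighbors_def)

lemma neighbors_commute:
  assumes "i \<in> {1..M}" "j \<in> neighbors \<Omega> M x i"
  shows "i \<in> neighbors \<Omega> M x j"
  using assms by (auto simp: neighbors_def face_length_commute[of \<Omega> M x i])

text \<open>By \<open>outer_unit_normal_face\<close> the normal points along
  \<open>x j - x i\<close>, so exchanging the nodes reverses it, while the midpoint at which
  \<open>v\<close> is evaluated stays the same.\<close>

lemma normal_velocity_swap:
  assumes "i \<in> {1..M}" "j \<in> neighbors \<Omega> M x i"
  shows "normal_velocity \<Omega> M x v j i = - normal_velocity \<Omega> M x v i j"
proof -
  have "j \<in> {1..M}" using assms(2) by (simp add: neighbors_def)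
  moreover have "x i - x j = - (x j - x i)" by simp
  ultimately show ?thesis
    unfolding normal_velocity_def
    using outer_unit_normal_face[OF assms] outer_unit_normal_face[OF _ neighbors_commute[OF assms]]
    by (simp only: dist_commute[of "x j"] midpoint_sym[of "x j"] inner_minus_right
        scaleR_minus_right)
qed

text \<open>This identifies the off-diagonal coefficients of the divergent upwind scheme as
  transposed diagonal contributions.\<close>

lemma velocity_pos_swap:
  assumes "i \<in> {1..M}" "j \<in> neighbors \<Omega> M x i"
  shows "velocity_pos \<Omega> M x v j i = - velocity_neg \<Omega> M x v i j"
  unfolding velocity_pos_def velocity_neg_def normal_velocity_swap[OF assms]
  by (simp add: algebra_simps)

section \<open>Boundary nodes and control volumes of a Voronoi grid\<close>

locale voronoi_grid =
  fixes \<Omega> :: "(real^2) set" and M :: nat and x :: "nat \<Rightarrow> real^2"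
  assumes polygon: "convex_polygon \<Omega>"
    and nodes_distinct: "inj_on x {1..M}"
    and nodes_subset: "x ` {1..M} \<subseteq> closure \<Omega>"
    and nodes_vertices: "vertices \<Omega> \<subseteq> x ` {1..M}"
    and connected: "grid_connected \<Omega> M x"
begin

lemma not_inner_iff_boundary:
  assumes "i \<in> {1..M}"
  shows "i \<notin> inner_nodes \<Omega> M x \<longleftrightarrow> i \<in> boundary_nodes \<Omega> M x"
proof -
  have "x i \<in> closure \<Omega>" "open \<Omega>"
    using assms nodes_subset polygon by (blast, simp add: convex_polygon_def)
  then show ?thesis
    using assms by (auto simp: inner_nodes_def boundary_nodes_def frontier_def interior_open)
qed

text \<open>The compact convex set \<open>closure \<Omega>\<close> has an extreme point. It is a
  vertex, hence a node, and it cannot lie in the open set \<Omega>. Both minimum principles reach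
  their contradiction at such a node.\<close>

lemma boundary_node_exists:
  obtains b where "b \<in> {1..M} - inner_nodes \<Omega> M x"
proof -
  have "compact (closure \<Omega>)" "convex (closure \<Omega>)" "closure \<Omega> \<noteq> {}" "open \<Omega>"
    using polygon polytope_imp_compact polytope_imp_convex by (auto simp only: convex_polygon_def closure_eq_empty)
  then obtain p where p: "p extreme_point_of (closure \<Omega>)"
    using extreme_point_exists_convex by blast
  then obtain b where b: "b \<in> {1..M}" "x b = p"
    using nodes_vertices by (auto simp: vertices_def)
  have "p \<notin> interior (closure \<Omega>)"
    using p extreme_point_not_in_interior by blast
  moreover have "\<Omega> \<subseteq> interior (closure \<Omega>)"
    using \<open>open \<Omega>\<close> by (simp add: interior_maximal closure_subset)
  ultimately show thesis using b that by (auto simp: inner_nodes_def)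
qed

text \<open>An inner node lies in its own open control volume because the nodes are distinct, so the
  volume contains a ball.\<close>

lemma area_pos:
  assumes "i \<in> inner_nodes \<Omega> M x"
  shows "area \<Omega> M x i > 0"
proof -
  let ?C = "control_volume \<Omega> M x i"
  have "open ?C"
    using polygon control_volume_open by (auto simp: convex_polygon_def)
  have "x i \<noteq> x j" if "j \<in> {1..M} - {i}" for j
    using that assms inj_onD[OF nodes_distinct, of i j] by (auto simp: inner_nodes_def)
  then have "x i \<in> ?C"
    using assms by (auto simp: control_volume_def inner_nodes_def)
  \<comment> \<open>Boundedness keeps the area finite; \<open>measure\<close> would return 0 on a
    set of infinite measure.\<close>
  have "bounded \<Omega>"
    using polygon bounded_subset[OF polytope_imp_bounded closure_subset]
    unfolding convex_polygon_def by blast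
  then have "bounded ?C"
    by (rule bounded_subset) (auto simp: control_volume_def)
  obtain e where e: "e > 0" "ball (x i) e \<subseteq> ?C"
    using \<open>open ?C\<close> \<open>x i \<in> ?C\<close> open_contains_ball by blast
  have "0 < measure lborel (ball (x i) e)"
    using e(1) content_ball_pos by (simp add: measure_completion)
  also have "\<dots> \<le> measure lborel ?C"
    using e(2) \<open>open ?C\<close> \<open>bounded ?C\<close>
    by (intro measure_mono_fmeasurable fmeasurableI emeasure_bounded_finite) auto
  finally show ?thesis by (simp add: area_def)
qed

section \<open>Monotonicity criteria for the nondivergent and the divergent form\<close>

lemma monotone_scheme_nondivergent:
  assumes A: "\<And>y i. i \<in> inner_nodes \<Omega> M x \<Longrightarrow>
      A y i = 1 / area \<Omega> M x i * (\<Sum>j\<in>neighbors \<Omega> M x i. a i j * (y i - y j))"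
    and pos: "\<And>i j. i \<in> inner_nodes \<Omega> M x \<Longrightarrow> j \<in> neighbors \<Omega> M x i \<Longrightarrow> a i j > 0"
  shows "monotone_scheme \<Omega> M x A"
proof (rule monotone_schemeI)
  show "A (\<lambda>j. - y j) i = - A y i" if "i \<in> inner_nodes \<Omega> M x" for y i
    using that by (simp add: A minus_divide_left sum_negf[symmetric] algebra_simps)
next
  fix y i
  assume A_nonneg: "\<And>i. i \<in> inner_nodes \<Omega> M x \<Longrightarrow> A y i \<ge> 0"
    and bdry: "\<And>i. i \<in> boundary_nodes \<Omega> M x \<Longrightarrow> y i = 0"
    and i: "i \<in> inner_nodes \<Omega> M x"
  obtain b where b: "b \<in> {1..M} - inner_nodes \<Omega> M x" by (rule boundary_node_exists)
  have "0 \<le> (\<Sum>j\<in>neighbors \<Omega> M x m. a m j * (y m - y j))" if "m \<in> inner_nodes \<Omega> M x" for m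
    using A_nonneg[OF that] area_pos[OF that] A[OF that] by (simp add: zero_le_divide_iff)
  moreover have "y j \<ge> 0" if "j \<in> {1..M} - inner_nodes \<Omega> M x" for j
    using that bdry not_inner_iff_boundary by fastforce
  moreover have "inner_nodes \<Omega> M x \<subseteq> {1..M}"
    by (auto simp: inner_nodes_def)
  ultimately show "y i \<ge> 0"
    using minimum_principle[OF _ neighbors_subset _ connected[unfolded grid_connected_def] b,
        where y = y and a = a] pos i by simp
qed

text \<open>Positivity is required in both directions of an edge, because \<open>j\<close> may be a
  boundary node, whose coefficient \<open>a j i\<close> enters the row of \<open>i\<close>.\<close>

lemma monotone_scheme_divergent:
  assumes A: "\<And>y i. i \<in> inner_nodes \<Omega> M x \<Longrightarrow>
      A y i = 1 / area \<Omega> M x i * (\<Sum>j\<in>neighbors \<Omega> M x i. a i j * y i - a j i * y j)"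
    and pos: "\<And>i j. i \<in> inner_nodes \<Omega> M x \<Longrightarrow> j \<in> neighbors \<Omega> M x i \<Longrightarrow>
      a i j > 0 \<and> a j i > 0"
  shows "monotone_scheme \<Omega> M x A"
proof (rule monotone_schemeI)
  show "A (\<lambda>j. - y j) i = - A y i" if "i \<in> inner_nodes \<Omega> M x" for y i
    using that by (simp add: A minus_divide_left sum_negf[symmetric] algebra_simps)
next
  fix y i
  assume A_nonneg: "\<And>i. i \<in> inner_nodes \<Omega> M x \<Longrightarrow> A y i \<ge> 0"
    and bdry: "\<And>i. i \<in> boundary_nodes \<Omega> M x \<Longrightarrow> y i = 0"
    and i: "i \<in> inner_nodes \<Omega> M x"
  obtain b where b: "b \<in> {1..M} - inner_nodes \<Omega> M x" by (rule boundary_node_exists)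
  have "0 \<le> (\<Sum>j\<in>neighbors \<Omega> M x m. a m j * y m - a j m * y j)"
    if "m \<in> inner_nodes \<Omega> M x" for m
    using A_nonneg[OF that] area_pos[OF that] A[OF that] by (simp add: zero_le_divide_iff)
  moreover have "y j \<ge> 0" if "j \<in> {1..M} - inner_nodes \<Omega> M x" for j
    using that bdry not_inner_iff_boundary by fastforce
  moreover have "inner_nodes \<Omega> M x \<subseteq> {1..M}"
    by (auto simp: inner_nodes_def)
  ultimately show "y i \<ge> 0"
    using minimum_principle_transposed[OF _ neighbors_subset _ connected[unfolded grid_connected_def] b,
        where y = y and a = a] neighbors_commute pos i by simp
qed

text \<open>The midpoint of two nodes can miss their common face, but convexity keeps it in
  \<open>closure \<Omega>\<close>, where the lower bound on \<open>k\<close> holds.\<close>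

lemma neighbor_data_pos:
  assumes "i \<in> {1..M}" "j \<in> neighbors \<Omega> M x i"
  shows "face_length \<Omega> M x i j > 0" "dist (x i) (x j) > 0"
    "midpoint (x i) (x j) \<in> closure \<Omega>"
proof -
  have j: "j \<in> {1..M}" "j \<noteq> i" and "face_length \<Omega> M x i j > 0"
    using assms(2) by (auto simp: neighbors_def)
  then show "face_length \<Omega> M x i j > 0" by simp
  show "dist (x i) (x j) > 0"
    using assms(1) j inj_onD[OF nodes_distinct, of i j] by auto
  have "convex (closure \<Omega>)"
    using polygon by (simp add: convex_polygon_def convex_closure)
  then have "closed_segment (x i) (x j) \<subseteq> closure \<Omega>"
    using nodes_subset assms(1) j by (intro closed_segment_subset) auto
  then show "midpoint (x i) (x j) \<in> closure \<Omega>"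
    using midpoint_in_closed_segment by blast
qed

end

section \<open>Coefficients of the four schemes\<close>

theorem theorem8:
  fixes \<Omega> :: "(real^2) set" and M :: nat and x :: "nat \<Rightarrow> real^2"
    and k :: "real^2 \<Rightarrow> real" and v :: "real^2 \<Rightarrow> real^2" and \<kappa>\<^sub>1 :: real
  assumes polygon: "convex_polygon \<Omega>"
    and nodes_distinct: "inj_on x {1..M}"
    and nodes_subset: "x ` {1..M} \<subseteq> closure \<Omega>"
    and nodes_vertices: "vertices \<Omega> \<subseteq> x ` {1..M}"
    and connected: "grid_connected \<Omega> M x"
    and k_smooth: "C1_on (closure \<Omega>) k"
    and v_smooth: "C1_on (closure \<Omega>) v"
    and \<kappa>\<^sub>1_pos: "\<kappa>\<^sub>1 > 0"
    and k_ge: "\<And>p. p \<in> closure \<Omega> \<Longrightarrow> k p \<ge> \<kappa>\<^sub>1"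
  shows
    "(monotone_scheme \<Omega> M x
         (\<lambda>y i. upwind_nondivergent \<Omega> M x v y i + diffusion \<Omega> M x k y i) \<and>
      monotone_scheme \<Omega> M x
         (\<lambda>y i. upwind_divergent \<Omega> M x v y i + diffusion \<Omega> M x k y i)) \<and>
     ((\<forall>i\<in>inner_nodes \<Omega> M x. \<forall>j\<in>neighbors \<Omega> M x i. peclet \<Omega> M x k v i j < 2) \<longrightarrow>
      monotone_scheme \<Omega> M x
         (\<lambda>y i. central_nondivergent \<Omega> M x v y i + diffusion \<Omega> M x k y i) \<and>
      monotone_scheme \<Omega> M x
         (\<lambda>y i. central_divergent \<Omega> M x v y i + diffusion \<Omega> M x k y i))"
proof -
  interpret voronoi_grid \<Omega> M x
    by unfold_locales (fact polygon nodes_distinct nodes_subset nodes_vertices connected)+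
  define I where "I = inner_nodes \<Omega> M x"
  define W where "W = neighbors \<Omega> M x"
  define l where "l = face_length \<Omega> M x"
  define \<beta> where "\<beta> = normal_velocity \<Omega> M x v"
  define \<beta>p where "\<beta>p = velocity_pos \<Omega> M x v"
  define \<beta>n where "\<beta>n = velocity_neg \<Omega> M x v"
  \<comment> \<open>The diffusive coefficient per unit face length; it is symmetric, and the Peclet
    number is \<open>\<bar>\<beta> i j\<bar> / K i j\<close>.\<close>
  define K where "K i j = k (midpoint (x i) (x j)) / dist (x i) (x j)" for i j
  note defs = I_def W_def l_def \<beta>_def \<beta>p_def \<beta>n_def
  have I: "i \<in> {1..M}" if "i \<in> I" for i
    using that by (simp add: I_def inner_nodes_def)
  have K_sym: "K j i = K i j" and l_sym: "l j i = l i j" for i j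
    by (simp_all add: K_def l_def midpoint_sym dist_commute face_length_commute)
  have swap: "\<beta> j i = - \<beta> i j" "\<beta>p j i = - \<beta>n i j" if "i \<in> I" "j \<in> W i" for i j
    using normal_velocity_swap velocity_pos_swap I[OF that(1)] that(2) by (simp_all add: defs)
  have pos: "l i j > 0" "K i j > 0" if "i \<in> I" "j \<in> W i" for i j
    using neighbor_data_pos[OF I[OF that(1)]] that(2) k_ge \<kappa>\<^sub>1_pos
    by (force simp: defs K_def)+
  have sign: "\<beta>p i j \<ge> 0" "\<beta>n i j \<le> 0" for i j
    by (simp_all add: defs velocity_pos_def velocity_neg_def)
  have diff: "diffusion \<Omega> M x k y i = 1 / area \<Omega> M x i * (\<Sum>j\<in>W i. l i j * K i j * (y i - y j))"
    for y i
    unfolding diffusion_def mult_minus_left minus_mult_right sum_negf[symmetric] W_def[symmetric]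
    by (rule arg_cong2[where f = "(*)", OF refl], rule sum.cong[OF refl])
      (simp add: defs K_def diff_divide_distrib algebra_simps)
  have "monotone_scheme \<Omega> M x (\<lambda>y i. upwind_nondivergent \<Omega> M x v y i + diffusion \<Omega> M x k y i)"
  \<comment> \<open>Since \<open>\<beta>n\<close> is non-positive, upwind convection only enlarges
    the diffusive coefficient.\<close>
  proof (rule monotone_scheme_nondivergent[of _ "\<lambda>i j. l i j * (K i j - \<beta>n i j)"], fold I_def W_def)
    show "upwind_nondivergent \<Omega> M x v y i + diffusion \<Omega> M x k y i =
        1 / area \<Omega> M x i * (\<Sum>j\<in>W i. l i j * (K i j - \<beta>n i j) * (y i - y j))" for y i
      unfolding diff upwind_nondivergent_def distrib_left[symmetric] sum.distrib[symmetric]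
        defs(2-6)[symmetric]
      by (rule arg_cong2[where f = "(*)", OF refl], rule sum.cong[OF refl]) (auto simp: defs algebra_simps)
    show "l i j * (K i j - \<beta>n i j) > 0" if "i \<in> I" "j \<in> W i" for i j
      using pos[OF that] sign(2)[of i j] by simp
  qed
  moreover have "monotone_scheme \<Omega> M x
      (\<lambda>y i. upwind_divergent \<Omega> M x v y i + diffusion \<Omega> M x k y i)"
  \<comment> \<open>The coefficient of \<open>y j\<close> is minus
    \<open>l i j * (K i j - \<beta>n i j)\<close>, and \<open>swap\<close> turns
    \<open>- \<beta>n i j\<close> into \<open>\<beta>p j i\<close>, giving the transposed
    entry.\<close>
  proof (rule monotone_scheme_divergent[of _ "\<lambda>i j. l i j * (K i j + \<beta>p i j)"], fold I_def W_def)
    fix i assume i: "i \<in> I"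
    show "upwind_divergent \<Omega> M x v y i + diffusion \<Omega> M x k y i = 1 / area \<Omega> M x i *
        (\<Sum>j\<in>W i. l i j * (K i j + \<beta>p i j) * y i - l j i * (K j i + \<beta>p j i) * y j)" for y
      unfolding diff upwind_divergent_def distrib_left[symmetric] sum.distrib[symmetric]
        defs(2-6)[symmetric]
      by (rule arg_cong2[where f = "(*)", OF refl], rule sum.cong[OF refl])
        (auto simp: swap[OF i] K_sym[of _ i] l_sym[of _ i] algebra_simps)
    show "l i j * (K i j + \<beta>p i j) > 0 \<and> l j i * (K j i + \<beta>p j i) > 0" if "j \<in> W i" for j
      using pos[OF i that] sign(1)[of i j] sign(1)[of j i] by (simp add: K_sym[of j] l_sym[of j])
  qed
  moreover have "monotone_scheme \<Omega> M x
        (\<lambda>y i. central_nondivergent \<Omega> M x v y i + diffusion \<Omega> M x k y i) \<and>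
      monotone_scheme \<Omega> M x
        (\<lambda>y i. central_divergent \<Omega> M x v y i + diffusion \<Omega> M x k y i)"
    if Pe: "\<forall>i\<in>inner_nodes \<Omega> M x. \<forall>j\<in>neighbors \<Omega> M x i. peclet \<Omega> M x k v i j < 2"
  proof
    \<comment> \<open>The bound 2 on the Peclet number says exactly that half the normal velocity is
      dominated by \<open>K\<close>, whatever its sign.\<close>
    have small: "\<bar>\<beta> i j\<bar> / 2 < K i j" if "i \<in> I" "j \<in> W i" for i j
    proof -
      have "\<bar>\<beta> i j\<bar> / K i j < 2"
        using Pe that by (simp add: defs peclet_def K_def)
      then show ?thesis using pos(2)[OF that] by (simp add: divide_simps)
    qed
    show "monotone_scheme \<Omega> M x
        (\<lambda>y i. central_nondivergent \<Omega> M x v y i + diffusion \<Omega> M x k y i)"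
    proof (rule monotone_scheme_nondivergent[of _ "\<lambda>i j. l i j * (K i j - \<beta> i j / 2)"],
        fold I_def W_def)
      show "central_nondivergent \<Omega> M x v y i + diffusion \<Omega> M x k y i =
          1 / area \<Omega> M x i * (\<Sum>j\<in>W i. l i j * (K i j - \<beta> i j / 2) * (y i - y j))" for y i
        unfolding diff central_nondivergent_def distrib_left[symmetric] sum.distrib[symmetric]
        defs(2-6)[symmetric]
        by (rule arg_cong2[where f = "(*)", OF refl], rule sum.cong[OF refl]) (auto simp: defs field_simps)
      show "l i j * (K i j - \<beta> i j / 2) > 0" if "i \<in> I" "j \<in> W i" for i j
        using pos(1)[OF that] small[OF that] by simp
    qed
    show "monotone_scheme \<Omega> M x
        (\<lambda>y i. central_divergent \<Omega> M x v y i + diffusion \<Omega> M x k y i)"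
    \<comment> \<open>The transposed entry is \<open>l i j * (K i j - \<beta> i j / 2)\<close>, so
      \<open>small\<close> is used for both signs of \<open>\<beta> i j\<close>.\<close>
    proof (rule monotone_scheme_divergent[of _ "\<lambda>i j. l i j * (K i j + \<beta> i j / 2)"],
        fold I_def W_def)
      fix i assume i: "i \<in> I"
      show "central_divergent \<Omega> M x v y i + diffusion \<Omega> M x k y i = 1 / area \<Omega> M x i *
          (\<Sum>j\<in>W i. l i j * (K i j + \<beta> i j / 2) * y i - l j i * (K j i + \<beta> j i / 2) * y j)" for y
        unfolding diff central_divergent_def distrib_left[symmetric] sum.distrib[symmetric]
          defs(2-6)[symmetric]
        by (rule arg_cong2[where f = "(*)", OF refl], rule sum.cong[OF refl])
          (auto simp: swap[OF i] K_sym[of _ i] l_sym[of _ i] field_simps)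
      show "l i j * (K i j + \<beta> i j / 2) > 0 \<and> l j i * (K j i + \<beta> j i / 2) > 0" if "j \<in> W i" for j
        using pos(1)[OF i that] small[OF i that]
        by (simp add: swap[OF i that] K_sym[of j] l_sym[of j])
    qed
  qed
  ultimately show ?thesis by blast
qed

end
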